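(* Work in the "linear" axiomatic framework for three-dimensional projective space described in the context, assuming Axioms [1]–[4] together with Axiom [H]. Let $O,P,Q,R$ be the vertices of a complete quadrangle, and let $A$, $B$, $C$ be its diagonal points, namely $A$ is the intersection point of the lines $OP$ and $QR$, $B$ that of $OQ$ and $RP$, and $C$ that of $OR$ and $PQ$. Then $A, B, C$ are not collinear.
   Context: Let $\mathbb{L}$ be a set (whose elements are called lines) with a symmetric reflexive relation $\sim$ (incidence). Lines that are not incident are called skew. For $S \subseteq \mathbb{L}$ let $S^{\sim}$ be the set of all lines incident to every line of $S$, and write $[l_1 \dots l_n] = \{l_1,\dots,l_n\}^{\sim}$. The axioms are: Axiom [1]: for each line $l$, the set $\{l\}^{\sim}$ contains three pairwise skew lines. Axiom [2]: for each incident pair of distinct lines $a,b$: (2.1) $[ab]$ contains skew pairs of lines; (2.2) if $c \in [ab]\setminus[ab]^{\sim}$ is one of such a skew pair, then no skew pairs lie in $[abc]$; (2.3) if $x,y$ is a skew pair in $[ab]$ then $[ab] = [abx]\cup[aby]$. Axiom [3]: if $a,b$ is an incident line pair and $c \in [ab]\setminus[ab]^{\sim}$, then there exist an incident line pair $p,q$ and $r \in [pq]\setminus[pq]^{\sim}$ with $[abc]\cap[pqr]=\emptyset$. For incident distinct lines $a,b$ put $\Sigma(a,b) = [ab]\setminus[ab]^{\sim}$; incidence restricted to $\Sigma(a,b)$ is an equivalence relation with exactly two classes, which (as part of the structure) are labelled $\Sigma_{\mathrm{pt}}(a,b)$ and $\Sigma_{\mathrm{pl}}(a,b)$. The point $\mathrm{pt}(a,b)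 = [abc]$ with $c \in \Sigma_{\mathrm{pt}}(a,b)$ and the plane $\mathrm{pl}(a,b) = [abc]$ with $c \in \Sigma_{\mathrm{pl}}(a,b)$ are independent of the choice of $c$. Axiom [4]: whenever $a,b$ and $p,q$ are pairs of distinct incident lines, $\mathrm{pt}(a,b)\cap\mathrm{pt}(p,q)\neq\emptyset$ and $\mathrm{pl}(a,b)\cap\mathrm{pl}(p,q)\neq\emptyset$. Points are the sets $\mathrm{pt}(a,b)$ and planes the sets $\mathrm{pl}(a,b)$ ($a\ne b$ incident); a line lies on a point/plane if it is an element of it. A point and a plane are incident if their intersection is nonempty. Points are collinear if some line lies in all of them; points are coplanar if they are all incident with one plane. Two distinct points $X,Y$ have exactly one common line, denoted $XY$; two distinct coplanar lines $\ell, m$ are incident and lie in a unique common point, their intersection point. A complete quadrangle is a set of four coplanar points $O,P,Q,R$, no three of which are collinear. A triad is a triple of pairwise-incident lines $a,b,c$ with $c \in \Sigma(a,b)$ (equivalently $a\in\Sigma(b,c)$, equivalently $b \in \Sigma(c,a)$). It is a plane-triad if $a\in\Sigma_{\mathrm{pl}}(b,c)$, $b\in\Sigma_{\mathrm{pl}}(c,a)$, $c\in\Sigma_{\mathrm{pl}}(a,b)$, and a point-triad if the same holds with $\mathrm{pt}$ in place of $\mathrm{pl}$. A plane-tetrad (resp. point-tetrad) is a set $\{o,p,q,r\}$ of four pairwise-incident lines such that each of $\{p,q,r\},\{o,q,r\},\{o,r,p\},\{o,p,q\}$ is a plane-triad (resp. point-triad). The diagonals of a plane-tetrad are the unique lines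 $a\in\mathrm{pt}(o,p)\cap\mathrm{pt}(q,r)$, $b\in\mathrm{pt}(o,q)\cap\mathrm{pt}(r,p)$, $c\in\mathrm{pt}(o,r)\cap\mathrm{pt}(p,q)$; the diagonals of a point-tetrad are the unique lines $a\in\mathrm{pl}(o,p)\cap\mathrm{pl}(q,r)$, $b\in\mathrm{pl}(o,q)\cap\mathrm{pl}(r,p)$, $c\in\mathrm{pl}(o,r)\cap\mathrm{pl}(p,q)$. Axiom [H]: the diagonals of a plane-tetrad form a plane-triad, and the diagonals of a point-tetrad form a point-triad. *)

theory Defs
  imports Main
begin

text \<open>
  The labelling of the two classes of each \<open>\<Sigma>(a,b)\<close> is part of the structure, hence the
  fields \<open>Sigma_pt\<close> and \<open>Sigma_pl\<close>. Their values are only meaningful for distinct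
  incident \<open>a\<close>, \<open>b\<close>.
\<close>

record 'l line_structure =
  lines :: "'l set"
  inc :: "'l \<Rightarrow> 'l \<Rightarrow> bool"
  Sigma_pt :: "'l \<Rightarrow> 'l \<Rightarrow> 'l set"
  Sigma_pl :: "'l \<Rightarrow> 'l \<Rightarrow> 'l set"

definition skew :: "('l, 'm) line_structure_scheme \<Rightarrow> 'l \<Rightarrow> 'l \<Rightarrow> bool" where
  "skew G x y \<longleftrightarrow> \<not> inc G x y"

definition perp :: "('l, 'm) line_structure_scheme \<Rightarrow> 'l set \<Rightarrow> 'l set" where
  "perp G S = {l \<in> lines G. \<forall>s\<in>S. inc G l s}"

definition incident_pair :: "('l, 'm) line_structure_scheme \<Rightarrow> 'l \<Rightarrow> 'l \<Rightarrow> bool" where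
  "incident_pair G a b \<longleftrightarrow> a \<in> lines G \<and> b \<in> lines G \<and> a \<noteq> b \<and> inc G a b"

definition Sig :: "('l, 'm) line_structure_scheme \<Rightarrow> 'l \<Rightarrow> 'l \<Rightarrow> 'l set" where
  "Sig G a b = perp G {a, b} - perp G (perp G {a, b})"

definition inc_on :: "('l, 'm) line_structure_scheme \<Rightarrow> 'l set \<Rightarrow> ('l \<times> 'l) set" where
  "inc_on G S = {(x, y). x \<in> S \<and> y \<in> S \<and> inc G x y}"

locale line_geometry =
  fixes G :: "('l, 'm) line_structure_scheme"
  assumes inc_refl: "reflp_on (lines G) (inc G)"
    and inc_sym: "symp_on (lines G) (inc G)"
    and ax1: "l \<in> lines G \<Longrightarrow>
      \<exists>x\<in>perp G {l}. \<exists>y\<in>perp G {l}. \<exists>z\<in>perp G {l}. skew G x y \<and> skew G y z \<and> skew G z x"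
    and ax2_1: "incident_pair G a b \<Longrightarrow> \<exists>x\<in>perp G {a, b}. \<exists>y\<in>perp G {a, b}. skew G x y"
    and ax2_2: "\<lbrakk>incident_pair G a b; c \<in> Sig G a b\<rbrakk> \<Longrightarrow>
      \<not> (\<exists>x\<in>perp G {a, b, c}. \<exists>y\<in>perp G {a, b, c}. skew G x y)"
    and ax2_3: "\<lbrakk>incident_pair G a b; x \<in> perp G {a, b}; y \<in> perp G {a, b}; skew G x y\<rbrakk> \<Longrightarrow>
      perp G {a, b} = perp G {a, b, x} \<union> perp G {a, b, y}"
    and ax3: "\<lbrakk>incident_pair G a b; c \<in> Sig G a b\<rbrakk> \<Longrightarrow>
      \<exists>p q r. incident_pair G p q \<and> r \<in> Sig G p q \<and> perp G {a, b, c} \<inter> perp G {p, q, r} = {}"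
begin

lemma Sig_subset_lines: "Sig G a b \<subseteq> lines G"
  by (auto simp: Sig_def perp_def)

lemma equiv_Sig:
  assumes "incident_pair G a b"
  shows "equiv (Sig G a b) (inc_on G (Sig G a b))"
proof (rule equivI)
  show "inc_on G (Sig G a b) \<subseteq> Sig G a b \<times> Sig G a b"
    by (auto simp: inc_on_def)
  show "refl_on (Sig G a b) (inc_on G (Sig G a b))"
    using inc_refl Sig_subset_lines[of a b] by (auto simp: refl_on_def inc_on_def reflp_on_def)
  show "sym (inc_on G (Sig G a b))"
    using inc_sym Sig_subset_lines[of a b] by (auto simp: sym_def inc_on_def symp_on_def)
  show "trans (inc_on G (Sig G a b))"
  proof (rule transI)
    fix x y z
    assume "(x, y) \<in> inc_on G (Sig G a b)" "(y, z) \<in> inc_on G (Sig G a b)"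
    then have S: "x \<in> Sig G a b" "y \<in> Sig G a b" "z \<in> Sig G a b"
      and xy: "inc G x y" and yz: "inc G y z"
      by (auto simp: inc_on_def)
    have "z \<in> lines G" "y \<in> lines G"
      using S Sig_subset_lines by blast+
    then have zy: "inc G z y"
      using yz inc_sym by (auto simp: symp_on_def)
    have "x \<in> perp G {a, b, y}" "z \<in> perp G {a, b, y}"
      using S xy zy by (auto simp: Sig_def perp_def)
    then have "inc G x z"
      using ax2_2[OF assms S(2)] by (auto simp: skew_def)
    then show "(x, z) \<in> inc_on G (Sig G a b)"
      using S by (simp add: inc_on_def)
  qed
qed

text \<open>The axioms so far force exactly two classes, so the labelling introduced below exists.\<close>

lemma card_Sig_classes:
  assumes ab: "incident_pair G a b"
  shows "card (Sig G a b // inc_on G (Sig G a b)) = 2"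
proof -
  let ?S = "Sig G a b" and ?R = "inc_on G (Sig G a b)"
  obtain x y where x: "x \<in> perp G {a, b}" and y: "y \<in> perp G {a, b}" and xy: "skew G x y"
    using ax2_1[OF ab] by blast
  have yx: "\<not> inc G y x"
    using x y xy inc_sym by (auto simp: symp_on_def skew_def perp_def)
  have xS: "x \<in> ?S" and yS: "y \<in> ?S"
    using x y xy yx by (auto simp: Sig_def perp_def skew_def)
  have cover: "(z, x) \<in> ?R \<or> (z, y) \<in> ?R" if "z \<in> ?S" for z
  proof -
    have "z \<in> perp G {a, b, x} \<union> perp G {a, b, y}"
      using ax2_3[OF ab x y xy] that by (auto simp: Sig_def)
    then show ?thesis
      using that xS yS by (auto simp: perp_def inc_on_def)
  qed
  have "?S // ?R = {?R `` {x}, ?R `` {y}}"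
  proof
    show "?S // ?R \<subseteq> {?R `` {x}, ?R `` {y}}"
    proof
      fix X assume "X \<in> ?S // ?R"
      then obtain z where "z \<in> ?S" "X = ?R `` {z}"
        by (rule quotientE)
      then show "X \<in> {?R `` {x}, ?R `` {y}}"
        using cover[of z] equiv_class_eq[OF equiv_Sig[OF ab]] by blast
    qed
    show "{?R `` {x}, ?R `` {y}} \<subseteq> ?S // ?R"
      using xS yS by (auto intro: quotientI)
  qed
  moreover have "?R `` {x} \<noteq> ?R `` {y}"
    using eq_equiv_class_iff[OF equiv_Sig[OF ab] xS yS] xy by (auto simp: inc_on_def skew_def)
  ultimately show ?thesis
    by simp
qed

end

text \<open>
  The line \<open>c\<close> in \<open>[abc]\<close> is chosen arbitrarily; independence of the choice is proved below.
\<close>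

definition pt :: "('l, 'm) line_structure_scheme \<Rightarrow> 'l \<Rightarrow> 'l \<Rightarrow> 'l set" where
  "pt G a b = perp G {a, b, SOME c. c \<in> Sigma_pt G a b}"

definition pl :: "('l, 'm) line_structure_scheme \<Rightarrow> 'l \<Rightarrow> 'l \<Rightarrow> 'l set" where
  "pl G a b = perp G {a, b, SOME c. c \<in> Sigma_pl G a b}"

text \<open>
  \<open>\<Sigma>(a,b)\<close> depends only on the unordered pair \<open>{a,b}\<close>, and so does its labelling.
\<close>

locale labelled_line_geometry = line_geometry G
  for G :: "('l, 'm) line_structure_scheme" +
  assumes classes: "incident_pair G a b \<Longrightarrow>
      Sig G a b // inc_on G (Sig G a b) = {Sigma_pt G a b, Sigma_pl G a b}"
    and classes_distinct: "incident_pair G a b \<Longrightarrow> Sigma_pt G a b \<noteq> Sigma_pl G a b"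
    and Sigma_pt_commute: "incident_pair G a b \<Longrightarrow> Sigma_pt G a b = Sigma_pt G b a"
    and Sigma_pl_commute: "incident_pair G a b \<Longrightarrow> Sigma_pl G a b = Sigma_pl G b a"
begin

lemma perp_class:
  assumes ab: "incident_pair G a b" and X: "X \<in> Sig G a b // inc_on G (Sig G a b)"
    and c: "c \<in> X"
  shows "perp G {a, b, c} = perp G {a, b, SOME c. c \<in> X}"
proof -
  define d where "d = (SOME c. c \<in> X)"
  have d: "d \<in> X"
    unfolding d_def using c by (rule someI)
  have *: "perp G {a, b, u} \<subseteq> perp G {a, b, v}" if "u \<in> X" "v \<in> X" for u v
  proof
    fix z assume z: "z \<in> perp G {a, b, u}"
    have "(v, u) \<in> inc_on G (Sig G a b)"
      using quotient_eq_iff[OF equiv_Sig[OF ab] X X that(2,1)] by simp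
    then have uv: "u \<in> Sig G a b" "v \<in> perp G {a, b, u}"
      by (auto simp: inc_on_def Sig_def perp_def)
    then have "inc G z v"
      using ax2_2[OF ab uv(1)] z by (auto simp: skew_def)
    then show "z \<in> perp G {a, b, v}"
      using z by (auto simp: perp_def)
  qed
  show ?thesis
    using *[OF c d] *[OF d c] unfolding d_def by blast
qed

lemma pt_eq: "\<lbrakk>incident_pair G a b; c \<in> Sigma_pt G a b\<rbrakk> \<Longrightarrow> pt G a b = perp G {a, b, c}"
  using perp_class[of a b "Sigma_pt G a b" c] classes[of a b] by (simp add: pt_def)

lemma pl_eq: "\<lbrakk>incident_pair G a b; c \<in> Sigma_pl G a b\<rbrakk> \<Longrightarrow> pl G a b = perp G {a, b, c}"
  using perp_class[of a b "Sigma_pl G a b" c] classes[of a b] by (simp add: pl_def)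

end

definition points :: "('l, 'm) line_structure_scheme \<Rightarrow> 'l set set" where
  "points G = {pt G a b | a b. incident_pair G a b}"

definition planes :: "('l, 'm) line_structure_scheme \<Rightarrow> 'l set set" where
  "planes G = {pl G a b | a b. incident_pair G a b}"

definition collinear :: "('l, 'm) line_structure_scheme \<Rightarrow> 'l set set \<Rightarrow> bool" where
  "collinear G S \<longleftrightarrow> (\<exists>l\<in>lines G. \<forall>X\<in>S. l \<in> X)"

definition coplanar :: "('l, 'm) line_structure_scheme \<Rightarrow> 'l set set \<Rightarrow> bool" where
  "coplanar G S \<longleftrightarrow> (\<exists>\<pi>\<in>planes G. \<forall>X\<in>S. X \<inter> \<pi> \<noteq> {})"

definition common_line :: "'l set \<Rightarrow> 'l set \<Rightarrow> 'l" where
  "common_line X Y = (THE l. l \<in> X \<inter> Y)"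

definition intersection_point :: "('l, 'm) line_structure_scheme \<Rightarrow> 'l \<Rightarrow> 'l \<Rightarrow> 'l set" where
  "intersection_point G l m = (THE X. X \<in> points G \<and> l \<in> X \<and> m \<in> X)"

definition complete_quadrangle :: "('l, 'm) line_structure_scheme \<Rightarrow> 'l set set \<Rightarrow> bool" where
  "complete_quadrangle G S \<longleftrightarrow>
     S \<subseteq> points G \<and> card S = 4 \<and> coplanar G S \<and> (\<forall>T\<subseteq>S. card T = 3 \<longrightarrow> \<not> collinear G T)"

definition triad :: "('l, 'm) line_structure_scheme \<Rightarrow> 'l \<Rightarrow> 'l \<Rightarrow> 'l \<Rightarrow> bool" where
  "triad G a b c \<longleftrightarrow>
     incident_pair G a b \<and> incident_pair G b c \<and> incident_pair G c a \<and> c \<in> Sig G a b"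

definition plane_triad :: "('l, 'm) line_structure_scheme \<Rightarrow> 'l \<Rightarrow> 'l \<Rightarrow> 'l \<Rightarrow> bool" where
  "plane_triad G a b c \<longleftrightarrow>
     triad G a b c \<and> a \<in> Sigma_pl G b c \<and> b \<in> Sigma_pl G c a \<and> c \<in> Sigma_pl G a b"

definition point_triad :: "('l, 'm) line_structure_scheme \<Rightarrow> 'l \<Rightarrow> 'l \<Rightarrow> 'l \<Rightarrow> bool" where
  "point_triad G a b c \<longleftrightarrow>
     triad G a b c \<and> a \<in> Sigma_pt G b c \<and> b \<in> Sigma_pt G c a \<and> c \<in> Sigma_pt G a b"

text \<open>
  In the next two definitions the four lines are automatically distinct and pairwise incident,
  since any two of them belong to a common triad.
\<close>

definition plane_tetrad :: "('l, 'm) line_structure_scheme \<Rightarrow> 'l \<Rightarrow> 'l \<Rightarrow> 'l \<Rightarrow> 'l \<Rightarrow> bool" where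
  "plane_tetrad G k p q r \<longleftrightarrow>
     plane_triad G p q r \<and> plane_triad G k q r \<and> plane_triad G k r p \<and> plane_triad G k p q"

definition point_tetrad :: "('l, 'm) line_structure_scheme \<Rightarrow> 'l \<Rightarrow> 'l \<Rightarrow> 'l \<Rightarrow> 'l \<Rightarrow> bool" where
  "point_tetrad G k p q r \<longleftrightarrow>
     point_triad G p q r \<and> point_triad G k q r \<and> point_triad G k r p \<and> point_triad G k p q"

locale linear_projective_space = labelled_line_geometry G
  for G :: "('l, 'm) line_structure_scheme" +
  assumes ax4_pt: "\<lbrakk>incident_pair G a b; incident_pair G p q\<rbrakk> \<Longrightarrow> pt G a b \<inter> pt G p q \<noteq> {}"
    and ax4_pl: "\<lbrakk>incident_pair G a b; incident_pair G p q\<rbrakk> \<Longrightarrow> pl G a b \<inter> pl G p q \<noteq> {}"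

locale linear_projective_space_H = linear_projective_space G
  for G :: "('l, 'm) line_structure_scheme" +
  assumes axH_plane: "plane_tetrad G k p q r \<Longrightarrow>
      plane_triad G (common_line (pt G k p) (pt G q r)) (common_line (pt G k q) (pt G r p))
        (common_line (pt G k r) (pt G p q))"
    and axH_point: "point_tetrad G k p q r \<Longrightarrow>
      point_triad G (common_line (pl G k p) (pl G q r)) (common_line (pl G k q) (pl G r p))
        (common_line (pl G k r) (pl G p q))"

end

theory Submission
  imports Defs
begin

text \<open>
  The sides \<open>OP\<close>, \<open>PQ\<close>, \<open>QR\<close>, \<open>RO\<close> of the quadrangle are coplanar, no three of them concurrent, so
  they form a plane-tetrad. Its diagonals are \<open>AC\<close>, \<open>PR\<close> and \<open>OQ\<close>; by Axiom [H] they form a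
  plane-triad, so \<open>AC\<close> does not pass through the intersection point \<open>B\<close> of \<open>PR\<close> and \<open>OQ\<close>.
\<close>

section \<open>Maximal families of pairwise incident lines\<close>

context line_geometry
begin

lemma inc_commute: "\<lbrakk>x \<in> lines G; y \<in> lines G\<rbrakk> \<Longrightarrow> inc G x y \<longleftrightarrow> inc G y x"
  using inc_sym by (auto simp: symp_on_def)

lemma inc_self: "x \<in> lines G \<Longrightarrow> inc G x x"
  using inc_refl by (auto simp: reflp_on_def)

lemma in_perp_triple: "\<lbrakk>incident_pair G a b; c \<in> Sig G a b\<rbrakk> \<Longrightarrow> {a, b, c} \<subseteq> perp G {a, b, c}"
  by (auto simp: incident_pair_def Sig_def perp_def inc_self inc_commute)

lemma perp_triple_clique:
  assumes "incident_pair G a b" "c \<in> Sig G a b" "x \<in> perp G {a, b, c}" "y \<in> perp G {a, b, c}"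
  shows "inc G x y"
  using ax2_2[OF assms(1,2)] assms(3,4) by (auto simp: skew_def)

text \<open>Sets \<open>perp G {a, b, c}\<close> of this kind are maximal cliques of incidence: a
  line incident with all members is incident with the three generators. So it suffices to find a
  member \<open>x\<close> of \<open>Sig G l m\<close>; the clique then lies in
  \<open>perp G {l, m, x}\<close>, and maximality gives equality.\<close>

lemma perp_triple_regenerate:
  assumes ab: "incident_pair G a b" and c: "c \<in> Sig G a b"
    and l: "l \<in> perp G {a, b, c}" and m: "m \<in> perp G {a, b, c}" and lm: "l \<noteq> m"
  shows "incident_pair G l m" "\<exists>x\<in>Sig G l m. perp G {a, b, c} = perp G {l, m, x}"
proof -
  let ?X = "perp G {a, b, c}"
  have clique: "inc G x y" if "x \<in> ?X" "y \<in> ?X" for x y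
    using perp_triple_clique[OF ab c that] .
  have lin: "?X \<subseteq> lines G"
    by (auto simp: perp_def)
  have abc: "{a, b, c} \<subseteq> ?X"
    using in_perp_triple[OF ab c] .
  show ip: "incident_pair G l m"
    using clique[OF l m] l m lm lin by (auto simp: incident_pair_def)
  have sub: "?X \<subseteq> perp G {l, m}"
  proof
    fix y assume "y \<in> ?X"
    then have "y \<in> lines G" "inc G y l" "inc G y m"
      using clique l m lin by blast+
    then show "y \<in> perp G {l, m}"
      by (simp add: perp_def)
  qed
  \<comment> \<open>Otherwise every line of \<open>perp G {l, m}\<close> would be incident with
    \<open>a\<close>, \<open>b\<close>, \<open>c\<close> and so lie in the clique \<open>?X\<close>,
    although Axiom (2.1) puts a skew pair in \<open>perp G {l, m}\<close>.\<close>
  have "\<not> ?X \<subseteq> perp G (perp G {l, m})"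
  proof
    assume "?X \<subseteq> perp G (perp G {l, m})"
    then have *: "inc G x y" if "x \<in> ?X" "y \<in> perp G {l, m}" for x y
      using that unfolding perp_def[of G "perp G {l, m}"] by blast
    have "perp G {l, m} \<subseteq> ?X"
    proof
      fix y assume y: "y \<in> perp G {l, m}"
      then have yl: "y \<in> lines G" by (simp add: perp_def)
      then have "inc G y z" if "z \<in> {a, b, c}" for z
        using *[OF _ y, of z] that abc lin inc_commute by blast
      then show "y \<in> ?X"
        using yl by (simp add: perp_def)
    qed
    then show False
      using ax2_1[OF ip] clique unfolding skew_def by blast
  qed
  then obtain x where x: "x \<in> ?X" "x \<in> Sig G l m"
    using sub by (auto simp: Sig_def)
  have 1: "?X \<subseteq> perp G {l, m, x}"
  proof
    fix y assume "y \<in> ?X"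
    then have "y \<in> lines G" "inc G y l" "inc G y m" "inc G y x"
      using clique l m x(1) lin by blast+
    then show "y \<in> perp G {l, m, x}"
      by (simp add: perp_def)
  qed
  have "perp G {l, m, x} \<subseteq> ?X"
  proof
    fix y assume y: "y \<in> perp G {l, m, x}"
    have "inc G y z" if "z \<in> {a, b, c}" for z
      using perp_triple_clique[OF ip x(2) y] that abc 1 by blast
    then show "y \<in> ?X"
      using y by (simp add: perp_def)
  qed
  then show "\<exists>x\<in>Sig G l m. ?X = perp G {l, m, x}"
    using 1 x(2) by blast
qed

end

section \<open>Points and planes attached to an incident pair\<close>

context labelled_line_geometry
begin

lemma Sig_eq: "incident_pair G a b \<Longrightarrow> Sig G a b = Sigma_pt G a b \<union> Sigma_pl G a b"
  using Union_quotient[OF equiv_Sig[of a b]] classes[of a b] by simp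

lemma Sigma_pt_nonempty: "incident_pair G a b \<Longrightarrow> \<exists>c. c \<in> Sigma_pt G a b"
  using in_quotient_imp_non_empty[OF equiv_Sig[of a b], of "Sigma_pt G a b"] classes[of a b] by auto

lemma Sigma_pl_nonempty: "incident_pair G a b \<Longrightarrow> \<exists>c. c \<in> Sigma_pl G a b"
  using in_quotient_imp_non_empty[OF equiv_Sig[of a b], of "Sigma_pl G a b"] classes[of a b] by auto

lemma Sigma_pt_pl_not_inc:
  assumes "incident_pair G a b" "x \<in> Sigma_pt G a b" "y \<in> Sigma_pl G a b"
  shows "\<not> inc G x y"
proof
  assume "inc G x y"
  then have "(x, y) \<in> inc_on G (Sig G a b)"
    using assms Sig_eq[OF assms(1)] by (auto simp: inc_on_def)
  then have "Sigma_pt G a b = Sigma_pl G a b"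
    using quotient_eqI[OF equiv_Sig[OF assms(1)]] assms classes[OF assms(1)] by blast
  then show False
    using classes_distinct[OF assms(1)] by simp
qed

lemma pt_cases:
  assumes "X \<in> points G"
  obtains a b c where "incident_pair G a b" "c \<in> Sig G a b" "c \<in> Sigma_pt G a b"
    "X = pt G a b" "X = perp G {a, b, c}"
proof -
  obtain a b where ab: "incident_pair G a b" "X = pt G a b"
    using assms by (auto simp: points_def)
  then obtain c where "c \<in> Sigma_pt G a b"
    using Sigma_pt_nonempty by blast
  then show thesis
    using that[of a b c] ab Sig_eq pt_eq by auto
qed

lemma pl_cases:
  assumes "X \<in> planes G"
  obtains a b c where "incident_pair G a b" "c \<in> Sig G a b" "c \<in> Sigma_pl G a b"
    "X = pl G a b" "X = perp G {a, b, c}"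
proof -
  obtain a b where ab: "incident_pair G a b" "X = pl G a b"
    using assms by (auto simp: planes_def)
  then obtain c where "c \<in> Sigma_pl G a b"
    using Sigma_pl_nonempty by blast
  then show thesis
    using that[of a b c] ab Sig_eq pl_eq by auto
qed

lemma pt_in_points: "incident_pair G a b \<Longrightarrow> pt G a b \<in> points G"
  by (auto simp: points_def)

lemma pl_in_planes: "incident_pair G a b \<Longrightarrow> pl G a b \<in> planes G"
  by (auto simp: planes_def)

lemma in_pt:
  assumes "incident_pair G a b"
  shows "a \<in> pt G a b" "b \<in> pt G a b"
proof -
  obtain c where "c \<in> Sigma_pt G a b"
    using Sigma_pt_nonempty[OF assms] by blast
  then show "a \<in> pt G a b" "b \<in> pt G a b"
    using in_perp_triple[OF assms, of c] Sig_eq[OF assms] pt_eq[OF assms, of c] by auto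
qed

lemma point_lines: "X \<in> points G \<Longrightarrow> l \<in> X \<Longrightarrow> l \<in> lines G"
  by (auto simp: points_def pt_def perp_def)

text \<open>A line of the point is incident with a member of \<open>Sigma_pt G a b\<close>, but
  lines of different classes are skew. This is how a plane-triad finally yields three lines without
  a common point.\<close>

lemma Sigma_pl_not_in_pt:
  assumes "incident_pair G a b" "x \<in> Sigma_pl G a b"
  shows "x \<notin> pt G a b"
proof
  assume x: "x \<in> pt G a b"
  obtain c where c: "c \<in> Sigma_pt G a b"
    using Sigma_pt_nonempty[OF assms(1)] by blast
  then have "inc G x c"
    using x pt_eq[OF assms(1) c] by (simp add: perp_def)
  then have "inc G c x"
    using inc_commute c assms Sig_eq[OF assms(1)] Sig_subset_lines[of a b] by blast
  then show False
    using Sigma_pt_pl_not_inc[OF assms(1) c assms(2)] by simp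
qed

text \<open>Such an \<open>x\<close> is incident with every line of \<open>perp G {a, b}\<close>, in
  particular with a representative of each class. Geometrically, it belongs to the pencil spanned by
  \<open>a\<close> and \<open>b\<close>.\<close>

lemma perp_perp_pt_pl:
  assumes "incident_pair G a b" "x \<in> perp G {a, b}" "x \<in> perp G (perp G {a, b})"
  shows "x \<in> pt G a b" "x \<in> pl G a b"
proof -
  obtain c d where cd: "c \<in> Sigma_pt G a b" "d \<in> Sigma_pl G a b"
    using Sigma_pt_nonempty[OF assms(1)] Sigma_pl_nonempty[OF assms(1)] by blast
  then have "c \<in> perp G {a, b}" "d \<in> perp G {a, b}"
    using Sig_eq[OF assms(1)] by (auto simp: Sig_def)
  then have "inc G x c" "inc G x d"
    using assms(3) unfolding perp_def[of G "perp G {a, b}"] by auto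
  then show "x \<in> pt G a b" "x \<in> pl G a b"
    using assms(2) pt_eq[OF assms(1) cd(1)] pl_eq[OF assms(1) cd(2)] by (auto simp: perp_def)
qed

lemma Sigma_pt_in_pt: "\<lbrakk>incident_pair G a b; x \<in> Sigma_pt G a b\<rbrakk> \<Longrightarrow> x \<in> pt G a b"
  using in_perp_triple[of a b x] Sig_eq[of a b] pt_eq[of a b x] by auto

lemma Sigma_pl_in_pl: "\<lbrakk>incident_pair G a b; x \<in> Sigma_pl G a b\<rbrakk> \<Longrightarrow> x \<in> pl G a b"
  using in_perp_triple[of a b x] Sig_eq[of a b] pl_eq[of a b x] by auto

text \<open>\<open>perp G {a, b}\<close> splits into the pencil and the two classes. The pencil lies
  in both the point and the plane, so a line outside one of them can only belong to the opposite
  class.\<close>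

lemma in_perp_cases:
  assumes "incident_pair G a b" "x \<in> perp G {a, b}"
  shows "x \<in> pt G a b \<or> x \<in> Sigma_pl G a b" "x \<in> pl G a b \<or> x \<in> Sigma_pt G a b"
  using perp_perp_pt_pl[OF assms] Sig_eq[OF assms(1)] assms(2)
    Sigma_pt_in_pt[OF assms(1)] Sigma_pl_in_pl[OF assms(1)]
  unfolding Sig_def by blast+

end

section \<open>Joining lines and intersection points under Axiom [4]\<close>

context linear_projective_space
begin

lemma points_meet: "\<lbrakk>X \<in> points G; Y \<in> points G\<rbrakk> \<Longrightarrow> \<exists>l\<in>X. l \<in> Y"
  using ax4_pt by (fastforce simp: points_def)

lemma planes_meet: "\<lbrakk>X \<in> planes G; Y \<in> planes G\<rbrakk> \<Longrightarrow> \<exists>l\<in>X. l \<in> Y"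
  using ax4_pl by (fastforce simp: planes_def)

text \<open>
  By Axiom [4], a set that is both a point and a plane would meet every point and every plane,
  whereas Axiom [3] provides a point or plane disjoint from it.
\<close>

lemma points_planes_disjoint:
  assumes "X \<in> points G"
  shows "X \<notin> planes G"
proof
  assume pl: "X \<in> planes G"
  obtain a b c where ab: "incident_pair G a b" "c \<in> Sig G a b" "X = perp G {a, b, c}"
    using pt_cases[OF assms] by metis
  obtain p q r where pq: "incident_pair G p q" "r \<in> Sig G p q" "X \<inter> perp G {p, q, r} = {}"
    using ax3[OF ab(1,2)] ab(3) by blast
  have "perp G {p, q, r} \<in> points G \<or> perp G {p, q, r} \<in> planes G"
    using pq(2) Sig_eq[OF pq(1)] pt_eq[OF pq(1)] pl_eq[OF pq(1)]
      pt_in_points[OF pq(1)] pl_in_planes[OF pq(1)] by fastforce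
  then show False
    using points_meet[OF assms] planes_meet[OF pl] pq(3) by blast
qed

text \<open>Regeneration writes \<open>X\<close> as \<open>perp G {l, m, x}\<close>. If
  \<open>x\<close> were in the plane class, \<open>X\<close> would be a plane as well as a point,
  which is excluded.\<close>

lemma point_eq_pt:
  assumes X: "X \<in> points G" and "l \<in> X" "m \<in> X" "l \<noteq> m"
  shows "incident_pair G l m" "X = pt G l m"
proof -
  obtain a b c where ab: "incident_pair G a b" "c \<in> Sig G a b" "X = perp G {a, b, c}"
    using pt_cases[OF X] by metis
  then show ip: "incident_pair G l m"
    using perp_triple_regenerate(1)[OF ab(1,2)] assms by simp
  obtain x where x: "x \<in> Sig G l m" "X = perp G {l, m, x}"
    using perp_triple_regenerate(2)[OF ab(1,2)] assms ab(3) by blast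
  have "x \<notin> Sigma_pl G l m"
    using points_planes_disjoint[OF X] x(2) pl_eq[OF ip] pl_in_planes[OF ip] by metis
  then show "X = pt G l m"
    using x Sig_eq[OF ip] pt_eq[OF ip] by auto
qed

lemma plane_eq_pl:
  assumes X: "X \<in> planes G" and "l \<in> X" "m \<in> X" "l \<noteq> m"
  shows "incident_pair G l m" "X = pl G l m"
proof -
  obtain a b c where ab: "incident_pair G a b" "c \<in> Sig G a b" "X = perp G {a, b, c}"
    using pl_cases[OF X] by metis
  then show ip: "incident_pair G l m"
    using perp_triple_regenerate(1)[OF ab(1,2)] assms by simp
  obtain x where x: "x \<in> Sig G l m" "X = perp G {l, m, x}"
    using perp_triple_regenerate(2)[OF ab(1,2)] assms ab(3) by blast
  have "x \<notin> Sigma_pt G l m"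
    using points_planes_disjoint[of X] X x(2) pt_eq[OF ip] pt_in_points[OF ip] by metis
  then show "X = pl G l m"
    using x Sig_eq[OF ip] pl_eq[OF ip] by auto
qed

lemma points_eqI:
  "\<lbrakk>X \<in> points G; Y \<in> points G; l \<in> X; l \<in> Y; m \<in> X; m \<in> Y; l \<noteq> m\<rbrakk> \<Longrightarrow> X = Y"
  using point_eq_pt(2) by metis

lemma common_line_eqI:
  assumes "X \<in> points G" "Y \<in> points G" "X \<noteq> Y" "l \<in> X" "l \<in> Y"
  shows "common_line X Y = l"
  unfolding common_line_def using points_eqI[OF assms(1,2)] assms by (intro the_equality) blast+

lemma common_line_in:
  assumes "X \<in> points G" "Y \<in> points G" "X \<noteq> Y"
  shows "common_line X Y \<in> X" "common_line X Y \<in> Y"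
  using points_meet[OF assms(1,2)] common_line_eqI[OF assms] by auto

lemma common_line_commute: "common_line X Y = common_line Y X"
  by (simp add: common_line_def Int_commute)

lemma intersection_point_eq:
  assumes "incident_pair G l m"
  shows "intersection_point G l m = pt G l m"
  unfolding intersection_point_def
proof (rule the_equality)
  show "pt G l m \<in> points G \<and> l \<in> pt G l m \<and> m \<in> pt G l m"
    using in_pt[OF assms] pt_in_points[OF assms] by simp
  show "X = pt G l m" if "X \<in> points G \<and> l \<in> X \<and> m \<in> X" for X
    using point_eq_pt(2)[of X l m] that assms by (simp add: incident_pair_def)
qed

text \<open>Take \<open>x\<close> in \<open>X\<close> and \<open>y\<close> in \<open>Y\<close>, both
  in \<pi>. The joining line is incident with both; were it in the point class of \<open>x\<close>
  and \<open>y\<close>, then \<open>X\<close> and \<open>Y\<close> would both equal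
  \<open>pt G x y\<close>. Hence it lies in \<open>pl G x y\<close>, which is \<pi>.\<close>

lemma common_line_in_plane:
  assumes X: "X \<in> points G" and Y: "Y \<in> points G" and "X \<noteq> Y" and \<pi>: "\<pi> \<in> planes G"
    and "X \<inter> \<pi> \<noteq> {}" "Y \<inter> \<pi> \<noteq> {}"
  shows "common_line X Y \<in> \<pi>"
proof -
  define l where "l = common_line X Y"
  have l: "l \<in> X" "l \<in> Y"
    using common_line_in[OF X Y \<open>X \<noteq> Y\<close>] by (simp_all add: l_def)
  obtain x y where x: "x \<in> X" "x \<in> \<pi>" and y: "y \<in> Y" "y \<in> \<pi>"
    using assms(5,6) by blast
  show ?thesis
  proof (cases "l = x \<or> l = y \<or> x = y")
    \<comment> \<open>If \<open>x = y\<close>, this line is common to \<open>X\<close> and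
      \<open>Y\<close> and so is the joining line itself.\<close>
    case True
    then show ?thesis
      using x y common_line_eqI[OF X Y \<open>X \<noteq> Y\<close>] by (auto simp: l_def)
  next
    case False
    then have ne: "l \<noteq> x" "l \<noteq> y" "x \<noteq> y" by auto
    have xy: "incident_pair G x y" "\<pi> = pl G x y"
      using plane_eq_pl[OF \<pi>] x y ne by auto
    have perp: "l \<in> perp G {x, y}"
      using point_eq_pt(1)[OF X l(1) x(1) ne(1)] point_eq_pt(1)[OF Y l(2) y(1) ne(2)]
      by (auto simp: incident_pair_def perp_def)
    have "l \<notin> Sigma_pt G x y"
    proof
      assume "l \<in> Sigma_pt G x y"
      then have *: "l \<in> pt G x y"
        by (rule Sigma_pt_in_pt[OF xy(1)])
      have "X = pt G x y" "Y = pt G x y"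
        using points_eqI[OF X pt_in_points[OF xy(1)] l(1) * x(1)]
          points_eqI[OF Y pt_in_points[OF xy(1)] l(2) * y(1)] in_pt[OF xy(1)] ne by auto
      then show False
        using \<open>X \<noteq> Y\<close> by simp
    qed
    then show ?thesis
      using in_perp_cases(2)[OF xy(1) perp] xy(2) by (simp add: l_def)
  qed
qed

section \<open>Plane-triads from coplanar lines without a common point\<close>

lemma coplanar_nonconcurrent_Sigma_pl:
  assumes \<pi>: "\<pi> \<in> planes G" "x \<in> \<pi>" "y \<in> \<pi>" "z \<in> \<pi>" and "x \<noteq> y" "y \<noteq> z" "z \<noteq> x"
    and nc: "\<And>X. \<lbrakk>X \<in> points G; x \<in> X; y \<in> X; z \<in> X\<rbrakk> \<Longrightarrow> False"
  shows "z \<in> Sigma_pl G x y"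
proof -
  have ip: "incident_pair G x y" "incident_pair G z x" "incident_pair G z y"
    using plane_eq_pl(1)[OF \<pi>(1)] assms by auto
  then have "z \<in> perp G {x, y}"
    by (auto simp: incident_pair_def perp_def)
  then show ?thesis
    using in_perp_cases(1)[OF ip(1)] nc[OF pt_in_points[OF ip(1)]] in_pt[OF ip(1)] by blast
qed

lemma plane_triadI:
  assumes \<pi>: "\<pi> \<in> planes G" "x \<in> \<pi>" "y \<in> \<pi>" "z \<in> \<pi>" and ne: "x \<noteq> y" "y \<noteq> z" "z \<noteq> x"
    and nc: "\<And>X. \<lbrakk>X \<in> points G; x \<in> X; y \<in> X; z \<in> X\<rbrakk> \<Longrightarrow> False"
  shows "plane_triad G x y z"
proof -
  have ip: "incident_pair G x y" "incident_pair G y z" "incident_pair G z x"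
    using plane_eq_pl(1)[OF \<pi>(1)] assms by auto
  \<comment> \<open>The hypotheses are invariant under rotating \<open>x\<close>, \<open>y\<close>,
    \<open>z\<close>, so one membership gives all three.\<close>
  have "z \<in> Sigma_pl G x y" "x \<in> Sigma_pl G y z" "y \<in> Sigma_pl G z x"
    using coplanar_nonconcurrent_Sigma_pl[OF \<pi> ne nc]
      coplanar_nonconcurrent_Sigma_pl[OF \<pi>(1,3,4,2) ne(2,3,1) nc]
      coplanar_nonconcurrent_Sigma_pl[OF \<pi>(1,4,2,3) ne(3,1,2) nc] by auto
  then show ?thesis
    using ip Sig_eq[OF ip(1)] by (simp add: plane_triad_def triad_def)
qed

text \<open>Equal sides would put one line on three successive vertices. A point \<open>V\<close> on
  all three sides shares two distinct lines with \<open>X\<close> and two with \<open>Y\<close>,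
  which forces \<open>X = V = Y\<close>.\<close>

lemma path_nonconcurrent:
  assumes pts: "W \<in> points G" "X \<in> points G" "Y \<in> points G" "Z \<in> points G"
    and nc: "\<not> collinear G {W, X, Y}" "\<not> collinear G {X, Y, Z}"
    and ne: "W \<noteq> X" "X \<noteq> Y" "Y \<noteq> Z"
  shows "common_line W X \<noteq> common_line X Y" "common_line X Y \<noteq> common_line Y Z"
    "common_line W X \<noteq> common_line Y Z"
    "\<lbrakk>V \<in> points G; common_line W X \<in> V; common_line X Y \<in> V; common_line Y Z \<in> V\<rbrakk> \<Longrightarrow> False"
proof -
  note cl = common_line_in[OF pts(1,2) ne(1)] common_line_in[OF pts(2,3) ne(2)]
    common_line_in[OF pts(3,4) ne(3)]
  have nc': "\<not> (l \<in> W \<and> l \<in> X \<and> l \<in> Y)" "\<not> (l \<in> X \<and> l \<in> Y \<and> l \<in> Z)" for l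
    using nc point_lines[OF pts(2)] by (auto simp: collinear_def)
  show ne1: "common_line W X \<noteq> common_line X Y" and ne2: "common_line X Y \<noteq> common_line Y Z"
    and "common_line W X \<noteq> common_line Y Z"
    using cl nc' by metis+
  assume V: "V \<in> points G" "common_line W X \<in> V" "common_line X Y \<in> V" "common_line Y Z \<in> V"
  have "V = X"
    using points_eqI[OF V(1) pts(2) V(2) _ V(3)] cl ne1 by blast
  moreover have "V = Y"
    using points_eqI[OF V(1) pts(3) V(3) _ V(4)] cl ne2 by blast
  ultimately show False
    using ne by simp
qed

text \<open>The sides are given as a set, so that one statement serves every order in which a tetrad
  lists them.\<close>

lemma path_plane_triad:
  assumes pts: "W \<in> points G" "X \<in> points G" "Y \<in> points G" "Z \<in> points G"
    and nc: "\<not> collinear G {W, X, Y}" "\<not> collinear G {X, Y, Z}"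
    and ne: "W \<noteq> X" "X \<noteq> Y" "Y \<noteq> Z"
    and \<pi>: "\<pi> \<in> planes G" "W \<inter> \<pi> \<noteq> {}" "X \<inter> \<pi> \<noteq> {}" "Y \<inter> \<pi> \<noteq> {}" "Z \<inter> \<pi> \<noteq> {}"
    and lines: "{x, y, z} = {common_line W X, common_line X Y, common_line Y Z}"
  shows "plane_triad G x y z"
proof (rule plane_triadI[OF \<pi>(1)])
  note path = path_nonconcurrent[OF pts nc ne]
  have "{x, y, z} \<subseteq> \<pi>"
    unfolding lines using common_line_in_plane \<pi> pts ne by simp
  then show "x \<in> \<pi>" "y \<in> \<pi>" "z \<in> \<pi>" by auto
  \<comment> \<open>Counting transfers distinctness of the sides to \<open>x\<close>,
    \<open>y\<close>, \<open>z\<close> without knowing which is which.\<close>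
  have "card {x, y, z} = 3"
    unfolding lines using path(1-3) by simp
  then show "x \<noteq> y" "y \<noteq> z" "z \<noteq> x"
    by (auto simp: card_insert_if split: if_splits)
  show False if V: "V \<in> points G" "x \<in> V" "y \<in> V" "z \<in> V" for V
  proof -
    have "{common_line W X, common_line X Y, common_line Y Z} \<subseteq> V"
      using V lines by auto
    then show False
      using path(4)[OF V(1)] by simp
  qed
qed

end

section \<open>The diagonal points of the quadrangle\<close>

theorem theorem4:
  fixes G :: "('l, 'm) line_structure_scheme"
    and O' P Q R A B C :: "'l set"
  assumes "linear_projective_space_H G"
    and "complete_quadrangle G {O', P, Q, R}"
    and "A = intersection_point G (common_line O' P) (common_line Q R)"
    and "B = intersection_point G (common_line O' Q) (common_line R P)"
    and "C = intersection_point G (common_line O' R) (common_line P Q)"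
  shows "\<not> collinear G {A, B, C}"
proof
  interpret linear_projective_space_H G by fact
  have pts: "O' \<in> points G" "P \<in> points G" "Q \<in> points G" "R \<in> points G"
    and card4: "card {O', P, Q, R} = 4"
    and nc: "\<And>T. \<lbrakk>T \<subseteq> {O', P, Q, R}; card T = 3\<rbrakk> \<Longrightarrow> \<not> collinear G T"
    using assms(2) by (auto simp: complete_quadrangle_def)
  obtain \<pi> where \<pi>: "\<pi> \<in> planes G"
    "O' \<inter> \<pi> \<noteq> {}" "P \<inter> \<pi> \<noteq> {}" "Q \<inter> \<pi> \<noteq> {}" "R \<inter> \<pi> \<noteq> {}"
    using assms(2) by (auto simp: complete_quadrangle_def coplanar_def)
  have ne: "O' \<noteq> P" "O' \<noteq> Q" "O' \<noteq> R" "P \<noteq> Q" "P \<noteq> R" "Q \<noteq> R"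
    using card4 by (auto simp: card_insert_if split: if_splits)
  have nc3: "\<not> collinear G {O', P, Q}" "\<not> collinear G {P, Q, R}" "\<not> collinear G {Q, R, O'}"
    "\<not> collinear G {R, O', P}"
    by (rule nc; use ne in simp)+
  \<comment> \<open>The naming makes \<open>k\<close>, \<open>p\<close> and \<open>q\<close>,
    \<open>r\<close> the pairs of opposite sides of the quadrilateral, so that the first diagonal in
    Axiom [H] joins \<open>A\<close> and \<open>C\<close>.\<close>
  define k p q r where "k = common_line O' P" and "p = common_line Q R"
    and "q = common_line P Q" and "r = common_line R O'"
  note defs = k_def p_def q_def r_def
  have tetrad: "plane_tetrad G k p q r"
    unfolding plane_tetrad_def
  proof (intro conjI)
    \<comment> \<open>Omitting one side of the closed quadrilateral leaves a path of three sides;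
      here \<open>k\<close> is omitted.\<close>
    show "plane_triad G p q r"
      by (rule path_plane_triad[of P Q R O' \<pi>]) (use pts nc3 ne \<pi> in \<open>simp_all add: defs insert_commute\<close>)
    show "plane_triad G k q r"
      by (rule path_plane_triad[of R O' P Q \<pi>]) (use pts nc3 ne \<pi> in \<open>simp_all add: defs insert_commute\<close>)
    show "plane_triad G k r p"
      by (rule path_plane_triad[of Q R O' P \<pi>]) (use pts nc3 ne \<pi> in \<open>simp_all add: defs insert_commute\<close>)
    show "plane_triad G k p q"
      by (rule path_plane_triad[of O' P Q R \<pi>]) (use pts nc3 ne \<pi> in \<open>simp_all add: defs insert_commute\<close>)
  qed
  have ip: "incident_pair G k p" "incident_pair G q r" "incident_pair G k q" "incident_pair G r p"
    "incident_pair G k r" "incident_pair G p q" "incident_pair G r q"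
    using tetrad by (auto simp: plane_tetrad_def plane_triad_def triad_def incident_pair_def inc_commute)
  have on: "k \<in> O'" "k \<in> P" "p \<in> Q" "p \<in> R" "q \<in> P" "q \<in> Q" "r \<in> R" "r \<in> O'"
    using common_line_in pts ne unfolding defs by metis+
  have neq: "k \<noteq> q" "r \<noteq> p" "k \<noteq> r" "p \<noteq> q"
    using ip by (auto simp: incident_pair_def)
  \<comment> \<open>Adjacent sides meet in the vertices, so the other two diagonals are
    \<open>PR\<close> and \<open>OQ\<close>.\<close>
  have vertices: "pt G k q = P" "pt G r p = R" "pt G k r = O'" "pt G p q = Q"
    using point_eq_pt(2) pts on neq by metis+
  have A: "A = pt G k p" and C: "C = pt G r q"
    using assms(3,5) intersection_point_eq[OF ip(1)] intersection_point_eq[OF ip(7)]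
    by (simp_all add: defs common_line_commute[of O' R])
  have Cqr: "C = pt G q r"
    using point_eq_pt(2)[OF pt_in_points[OF ip(7)], of q r] in_pt[OF ip(7)] ip(2) C
    by (simp add: incident_pair_def)
  have AC: "A \<in> points G" "C \<in> points G"
    using A C ip by (simp_all add: pt_in_points)
  \<comment> \<open>Only for distinct points is \<open>common_line A C\<close> determined. Equality
    would make the sides \<open>k\<close>, \<open>q\<close>, \<open>p\<close> of the path through
    \<open>O'\<close>, \<open>P\<close>, \<open>Q\<close>, \<open>R\<close> concurrent.\<close>
  have "A \<noteq> C"
  proof
    assume "A = C"
    then have "k \<in> A" "q \<in> A" "p \<in> A"
      using A C in_pt[OF ip(1)] in_pt[OF ip(7)] by auto
    then show False
      using path_nonconcurrent(4)[OF pts nc3(1,2), of A] ne AC(1) by (simp add: defs)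
  qed
  have triad: "plane_triad G (common_line A C) (common_line P R) (common_line O' Q)"
    using axH_plane[OF tetrad] by (simp add: A[symmetric] Cqr[symmetric] vertices)
  let ?b = "common_line R P" and ?c = "common_line O' Q"
  have bc: "incident_pair G ?b ?c" "common_line A C \<in> Sigma_pl G ?b ?c"
    using triad by (simp_all add: plane_triad_def triad_def common_line_commute[of P R])
  then have cb: "incident_pair G ?c ?b"
    using inc_commute unfolding incident_pair_def by metis
  have B: "B = pt G ?c ?b"
    using assms(4) intersection_point_eq[OF cb] by simp
  assume "collinear G {A, B, C}"
  then obtain l where l: "l \<in> A" "l \<in> B" "l \<in> C"
    by (auto simp: collinear_def)
  \<comment> \<open>A line through all three diagonal points must be the joining line of
    \<open>A\<close> and \<open>C\<close>, by uniqueness.\<close>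
  then have "common_line A C \<in> B"
    using common_line_eqI[OF AC \<open>A \<noteq> C\<close>] by simp
  moreover have "common_line A C \<notin> pt G ?c ?b"
    using Sigma_pl_not_in_pt[OF cb] bc(2) Sigma_pl_commute[OF cb] by simp
  ultimately show False
    using B by simp
qed

end
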